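(* Let $\Sigma$ be a finite alphabet and let $u,v\in\Sigma^*$ be words of equal length. Then $u$ and $v$ are cyclically equalizable if and only if $\Psi(u)=\Psi(v)$, i.e. $|u|_a=|v|_a$ for every letter $a\in\Sigma$.
   Context: For a word $w\in\Sigma^*$ and $a\in\Sigma$, $|w|_a$ is the number of occurrences of $a$ in $w$, and the Parikh vector of $w$ is $\Psi(w)=(|w|_a)_{a\in\Sigma}$. For $w=a_0a_1\cdots a_{n-1}$ with $n\ge 1$ and $r\in\mathbb{Z}_n$, the cyclic shift of $w$ by $r$ is $w^{(r)}=a_ra_{r+1}\cdots a_{n-1}a_0\cdots a_{r-1}$ (indices modulo $n$); two words $x,y$ of equal length are cyclically equivalent (conjugate) if $y=x^{(r)}$ for some integer $r$ (the empty word is cyclically equivalent to itself). Given words $w_1,\dots,w_k\in\Sigma^n$ with $w_i=a_{i,0}a_{i,1}\cdots a_{i,n-1}$, a simultaneous insertion transforms each $w_i$ into $x_0a_{i,0}x_1a_{i,1}\cdots x_{n-1}a_{i,n-1}x_n$, where $x_0,\dots,x_n\in\Sigma^*$ are words that are the same for all $i$. Words $w_1,\dots,w_k$ ($k\ge2$) of equal length are cyclically equalizable if there exist words $w_1',\dots,w_k'$ obtained from $w_1,\dots,w_k$ respectively by one simultaneous insertion such that $w_1',\dots,w_k'$ are pairwise cyclically equivalent. *)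

theory Defs
  imports "HOL-Library.FuncSet"
begin

definition parikh :: "'a set \<Rightarrow> 'a list \<Rightarrow> 'a \<Rightarrow> nat" where
  "parikh \<Sigma> w = (\<lambda>a\<in>\<Sigma>. count_list w a)"

(* rotate r reduces r modulo the length of its argument, so natural-number shifts
   cover all integer shifts; on the empty word it is the identity. *)
definition cyclically_equivalent :: "'a list \<Rightarrow> 'a list \<Rightarrow> bool" where
  "cyclically_equivalent x y \<longleftrightarrow> (\<exists>r. y = rotate r x)"

(* For w = a_0 ... a_(n-1) this is x_0 a_0 x_1 a_1 ... x_(n-1) a_(n-1) x_n;
   only x_0, ..., x_n matter. *)
definition insertion :: "(nat \<Rightarrow> 'a list) \<Rightarrow> 'a list \<Rightarrow> 'a list" where
  "insertion x w = concat (map (\<lambda>i. x i @ [w ! i]) [0..<length w]) @ x (length w)"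

(* The family w_1, ..., w_k is given as a list, so repetitions are allowed. *)
definition cyclically_equalizable :: "'a set \<Rightarrow> 'a list list \<Rightarrow> bool" where
  "cyclically_equalizable \<Sigma> ws \<longleftrightarrow>
     2 \<le> length ws \<and>
     (\<exists>n x. (\<forall>w\<in>set ws. w \<in> lists \<Sigma> \<and> length w = n) \<and>
            (\<forall>i\<le>n. x i \<in> lists \<Sigma>) \<and>
            (\<forall>w\<in>set ws. \<forall>w'\<in>set ws.
               cyclically_equivalent (insertion x w) (insertion x w')))"

end

theory Submission
  imports Defs "HOL-Combinatorics.Combinatorics"
begin

text \<open>
  Insertions preserve differences of Parikh vectors, so equalizable words have equal ones.
  Conversely, if v is a permutation of u, write \<open>v ! i = u ! \<pi> i\<close> and let g be the number of
  cycles of \<open>\<pi>\<close>. Rotation by \<open>g * m\<close> on \<open>g * (m * n - 1)\<close> positions has the g residue classes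
  modulo g as its orbits, since \<open>m * n\<close> is 1 modulo \<open>m * n - 1\<close>. Along each orbit the rotation
  sweeps again and again through the n blocks of \<open>g * m\<close> positions, at offset s within the blocks
  in sweep s. Hence the orbit belonging to a cycle can meet the letters of u in the order of that
  cycle: in sweep s we place the s-th index i of the cycle in block i. Filling the remaining
  positions of the orbit with the letter seen last makes the rotated word differ from the original
  one only at the chosen positions, where it carries v instead of u.
\<close>

section \<open>Insertions and subsequences\<close>

lemma insertion_Nil: "insertion x [] = x 0"
  by (simp add: insertion_def)

lemma insertion_Cons: "insertion x (a # w) = x 0 @ a # insertion (\<lambda>i. x (Suc i)) w"
  by (simp add: insertion_def upt_conv_Cons comp_def del: upt_Suc flip: map_Suc_upt)

lemma set_insertion: "set (insertion x w) = set w \<union> (\<Union>i\<le>length w. set (x i))"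
proof (induction w arbitrary: x)
  case (Cons a w)
  have "{..Suc (length w)} = insert 0 (Suc ` {..length w})"
    by (metis atMost_Suc_eq_insert_0)
  then show ?case
    by (auto simp: insertion_Cons Cons.IH)
qed (simp add: insertion_Nil)

lemma mset_insertion:
  "mset (insertion x w) = mset w + (\<Sum>i\<le>length w. mset (x i))"
  by (induction w arbitrary: x)
    (simp_all add: insertion_Nil insertion_Cons sum.atMost_Suc_shift del: sum.atMost_Suc)

text \<open>Positions outside \<open>A\<close> carry the same letter in both words, so these letters
  can be absorbed into the common \<open>x\<close>; the letters at \<open>A\<close> remain as the
  words into which \<open>x\<close> is inserted.\<close>

lemma insertion_nths:
  assumes "length xs = length ys"
    and "\<And>i. i < length xs \<Longrightarrow> i \<notin> A \<Longrightarrow> xs ! i = ys ! i"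
  shows "\<exists>x. xs = insertion x (nths xs A) \<and> ys = insertion x (nths ys A)"
  using assms
proof (induction xs ys arbitrary: A rule: list_induct2)
  case Nil
  show ?case by (auto simp: insertion_Nil)
next
  case (Cons a xs b ys)
  let ?A = "{j. Suc j \<in> A}"
  have "xs ! i = ys ! i" if "i < length xs" "i \<notin> ?A" for i
    using Cons.prems[of "Suc i"] that by simp
  from Cons.IH[of ?A, OF this] obtain x where
    x: "xs = insertion x (nths xs ?A)" "ys = insertion x (nths ys ?A)" by blast
  show ?case
  proof (cases "0 \<in> A")
    case True
    then have "a # xs = insertion (case_nat [] x) (nths (a # xs) A)"
      "b # ys = insertion (case_nat [] x) (nths (b # ys) A)"
      using x by (simp_all add: nths_Cons insertion_Cons)
    then show ?thesis by blast
  next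
    case False
    then have "a = b" using Cons.prems[of 0] by simp
    have push: "insertion (x(0 := c # x 0)) w = c # insertion x w" for c w
      by (cases w) (simp_all add: insertion_Nil insertion_Cons)
    have "a # xs = insertion (x(0 := a # x 0)) (nths (a # xs) A)"
      "b # ys = insertion (x(0 := a # x 0)) (nths (b # ys) A)"
      using False \<open>a = b\<close> x by (simp_all add: nths_Cons push)
    then show ?thesis by blast
  qed
qed

text \<open>An increasing \<open>p\<close> lists its image in ascending order, the order in which
  \<open>nths\<close> reads. This recovers \<open>u\<close> and \<open>v\<close> from the chosen
  positions.\<close>

lemma nths_strict_mono_on:
  fixes p :: "nat \<Rightarrow> nat"
  assumes "strict_mono_on {..<n} p" and "\<And>i. i < n \<Longrightarrow> p i < length xs"
  shows "nths xs (p ` {..<n}) = map (\<lambda>i. xs ! p i) [0..<n]"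
proof -
  have "filter (\<lambda>j. j \<in> p ` {..<n}) [0..<length xs] = map p [0..<n]"
  proof (rule sorted_distinct_set_unique)
    show "sorted (map p [0..<n])"
      using assms(1) by (auto simp: sorted_iff_nth_mono_less strict_mono_on_def less_imp_le)
    show "distinct (map p [0..<n])"
      using strict_mono_on_imp_inj_on[OF assms(1)] by (simp add: distinct_map lessThan_atLeast0)
    show "set (filter (\<lambda>j. j \<in> p ` {..<n}) [0..<length xs]) = set (map p [0..<n])"
      using assms(2) by auto
  qed (simp_all add: sorted_wrt_filter)
  moreover have "nths xs (p ` {..<n}) = map ((!) xs) (filter (\<lambda>j. j \<in> p ` {..<n}) [0..<length xs])"
  proof -
    have "nths (map ((!) xs) [0..<length xs]) I = map ((!) xs) (nths [0..<length xs] I)" for I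
      by (rule nths_map)
    moreover have "nths [0..<k] I = filter (\<lambda>j. j \<in> I) [0..<k]" for k I
      by (induction k) (simp_all add: nths_append)
    ultimately show ?thesis by (simp add: map_nth)
  qed
  ultimately show ?thesis by simp
qed

section \<open>Cycles of a permutation as lists\<close>

lemma permutes_cycle_lists:
  assumes "p permutes S" and "finite S"
  obtains css where "distinct (concat css)" and "set (concat css) = S"
    and "\<And>cs. cs \<in> set css \<Longrightarrow> cs \<noteq> [] \<and> map p cs = rotate1 cs"
proof -
  \<comment> \<open>That \<open>p\<close> fixes everything outside the set joins the induction: a
    new cycle is disjoint from \<open>I\<close>, so \<open>p\<close> acts trivially on it.\<close>
  have "(\<forall>x. x \<notin> S \<longrightarrow> p x = x) \<and> (\<exists>css. distinct (concat css) \<and> set (concat css) = S \<and>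
    (\<forall>cs\<in>set css. cs \<noteq> [] \<and> map p cs = rotate1 cs))"
    using cycle_decomposition[OF assms]
  proof (induction rule: cycle_decomp.induct)
    case empty
    show ?case by (auto intro: exI[of _ "[]"])
  next
    case (comp I p cs)
    from comp.IH obtain css where fix_p: "\<And>x. x \<notin> I \<Longrightarrow> p x = x"
      and css: "distinct (concat css)" "set (concat css) = I"
        "\<And>c. c \<in> set css \<Longrightarrow> c \<noteq> [] \<and> map p c = rotate1 c" by blast
    let ?q = "cycle_of_list cs \<circ> p"
    have "?q x = x" if "x \<notin> set cs \<union> I" for x
      using that fix_p by (simp add: id_outside_supp)
    moreover have old: "map ?q c = rotate1 c" if "c \<in> set css" for c
    proof -
      have "cycle_of_list cs (p x) = p x" if "x \<in> set c" for x
      proof (rule id_outside_supp)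
        have "p x \<in> set (map p c)" using that by simp
        then have "p x \<in> set c" using css(3)[OF \<open>c \<in> set css\<close>] by simp
        then show "p x \<notin> set cs" using css(2) \<open>c \<in> set css\<close> comp.hyps by auto
      qed
      then have "map ?q c = map p c" by simp
      then show ?thesis using css(3) that by simp
    qed
    moreover have new: "map ?q cs = rotate1 cs"
    proof -
      have "map ?q cs = map (cycle_of_list cs) cs"
        using comp.hyps fix_p by (auto simp: disjoint_iff)
      also have "\<dots> = rotate1 cs" using cyclic_rotation[OF comp.hyps(2), of 1] by simp
      finally show ?thesis .
    qed
    moreover have "\<exists>css. distinct (concat css) \<and> set (concat css) = set cs \<union> I \<and>
      (\<forall>cs\<in>set css. cs \<noteq> [] \<and> map ?q cs = rotate1 cs)"
    proof (cases "cs = []")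
      \<comment> \<open>\<open>cycle\<close> only demands distinctness and so admits the empty list,
        which is dropped here.\<close>
      case True
      then show ?thesis using css old by (intro exI[of _ css]) auto
    next
      case False
      then show ?thesis using css comp.hyps old new by (intro exI[of _ "cs # css"]) auto
    qed
    ultimately show ?case by blast
  qed
  then show ?thesis using that by blast
qed

section \<open>From a schedule to conjugate words\<close>

text \<open>
  In orbit q the letter \<open>h q s\<close> is filled in before the chosen position of sweep s and \<open>h q (Suc s)\<close>
  after it; \<open>c q s\<close> is the block of that position, a value \<open>\<ge> n\<close> meaning that there is none.
  Conversely index i is placed in orbit \<open>Q i\<close> and sweep \<open>T i\<close>.
\<close>
lemma equalizable_of_schedule:
  fixes c :: "nat \<Rightarrow> nat \<Rightarrow> nat" and h :: "nat \<Rightarrow> nat \<Rightarrow> 'a" and Q T :: "nat \<Rightarrow> nat"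
  assumes n: "n > 0" and m: "m \<ge> 2"
    and len: "length u = n" "length v = n"
    and at: "\<And>i. i < n \<Longrightarrow> Q i < g \<and> Suc (T i) < m \<and> c (Q i) (T i) = i"
    and u: "\<And>i. i < n \<Longrightarrow> u ! i = h (Q i) (T i)"
    and v: "\<And>i. i < n \<Longrightarrow> v ! i = h (Q i) (Suc (T i))"
    and c: "\<And>q s. q < g \<Longrightarrow> c q s < n \<Longrightarrow> Q (c q s) = q \<and> T (c q s) = s"
    and const: "\<And>q s. q < g \<Longrightarrow> c q s \<ge> n \<Longrightarrow> h q (Suc s) = h q s"
    and wrap: "\<And>q s. q < g \<Longrightarrow> s \<ge> m - 1 \<Longrightarrow> h q s = h q 0"
  shows "\<exists>x r. insertion x v = rotate r (insertion x u) \<and>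
    set (insertion x u) \<subseteq> (\<lambda>(q, s). h q s) ` ({..<g} \<times> UNIV)"
proof -
  define M where "M = m * n - 1"
  \<comment> \<open>Place \<open>b\<close> of an orbit lies in block \<open>b div m\<close> and
    sweep \<open>b mod m\<close>. \<open>F\<close> gives the letter in the original word,
    \<open>G\<close> the one in the rotated word; at the chosen block only \<open>G\<close> has
    already switched to the next letter.\<close>
  define F where "F q b = (if b div m \<le> c q (b mod m) then h q (b mod m) else h q (Suc (b mod m)))" for q b
  define G where "G q b = (if b div m < c q (b mod m) then h q (b mod m) else h q (Suc (b mod m)))" for q b
  define W where "W = map (\<lambda>j. F (j mod g) (j div g)) [0..<g * M]"
  define W' where "W' = map (\<lambda>j. G (j mod g) (j div g)) [0..<g * M]"
  define p where "p i = g * (i * m + T i) + Q i" for i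
  have g: "g > 0" using at[OF n] by simp
  have mn: "m * n \<ge> 2" using n m by (metis mult_le_mono One_nat_def Suc_leI mult.right_neutral)
  then have M: "M > 0" "m * n = Suc M" by (simp_all add: M_def)
  \<comment> \<open>Rotation by \<open>g * m\<close> advances \<open>m\<close> places in each
    orbit.\<close>
  have shift: "G q b = F q ((m + b) mod M)" if q: "q < g" and b: "b < M" for q b
  proof -
    define i s where "i = b div m" and "s = b mod m"
    have bis: "b = i * m + s" and s: "s < m" using m by (simp_all add: i_def s_def)
    have i: "i < n" using b M unfolding i_def
      by (metis less_SucI less_mult_imp_div_less mult.commute)
    consider "m + b < M" | "m + b = M" | "m + b > M" by linarith
    then show ?thesis
    proof cases
      \<comment> \<open>The sweep goes on to the next block, and \<open>i < c q s\<close> iff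
        \<open>Suc i \<le> c q s\<close>.\<close>
      case 1
      then have "(m + b) mod M = Suc i * m + s" by (simp add: bis)
      moreover have "(Suc i * m + s) div m = Suc i" "(Suc i * m + s) mod m = s"
        using s by (simp_all del: mult_Suc)
      ultimately show ?thesis
        by (simp add: F_def G_def less_eq_Suc_le flip: i_def s_def)
    next
      \<comment> \<open>The last block lacks its last place, so sweep \<open>m - 1\<close> ends one
        block early and the orbit closes at place 0. By \<open>wrap\<close> all letters involved
        equal \<open>h q 0\<close>.\<close>
      case 2
      then have "Suc i * m + Suc s = n * m" using M bis by (simp add: mult.commute)
      then have "s = m - 1"
        using s m
        by (metis Suc_lessI diff_Suc_1 lessI mod_less mod_mult_self2_is_0 mod_mult_self3 nat.distinct(1))
      then have "h q s = h q 0" "h q (Suc s) = h q 0" using wrap[OF q] by simp_all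
      then show ?thesis using 2 by (simp add: F_def G_def flip: i_def s_def)
    next
      \<comment> \<open>The sweep ends in block \<open>n - 1\<close>, and sweep \<open>Suc s\<close>
        starts in block 0 with letter \<open>h q (Suc s)\<close>.\<close>
      case 3
      have "\<not> Suc i < n"
      proof
        assume "Suc i < n"
        then have "Suc (Suc i) * m \<le> n * m" by (intro mult_le_mono1) simp
        then show False using 3 M s bis by (simp add: mult.commute)
      qed
      then have ni: "n = Suc i" using i by simp
      then have "m + b = M + Suc s" using M bis by (simp add: mult.commute algebra_simps)
      moreover have "Suc s < m" "Suc s \<le> M"
        using b bis ni M by (simp_all add: mult.commute)
      \<comment> \<open>This happens only for \<open>n = 1\<close>, where place \<open>Suc s\<close>
        is already place 0 again.\<close>
      moreover have "h q 0 = h q (Suc s)" if "Suc s = M"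
        using wrap[OF q, of "Suc s"] M ni that by simp
      ultimately have "F q ((m + b) mod M) = h q (Suc s)"
        by (cases "Suc s = M") (auto simp: F_def simp del: add_Suc_right)
      moreover have "G q b = h q (Suc s)"
        using const[OF q, of s] ni by (auto simp: G_def simp flip: i_def s_def)
      ultimately show ?thesis by simp
    qed
  qed
  have rot: "W' = rotate (g * m) W"
  proof (rule nth_equalityI)
    fix j assume "j < length W'"
    then have j: "j < g * M" by (simp add: W'_def)
    \<comment> \<open>As \<open>g\<close> divides both the shift and the length, the residue modulo
      \<open>g\<close> is kept and the quotient moves by \<open>m\<close> modulo
      \<open>M\<close>.\<close>
    have "(g * m + j) mod (g * M) = g * ((m + j div g) mod M) + j mod g"
      using g by (simp add: mod_mult2_eq)
    then have "((g * m + j) mod (g * M)) mod g = j mod g"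
      "((g * m + j) mod (g * M)) div g = (m + j div g) mod M"
      using g by simp_all
    moreover have "j div g < M" using j by (simp add: less_mult_imp_div_less mult.commute)
    ultimately show "W' ! j = rotate (g * m) W ! j"
      using j g M shift[of "j mod g" "j div g"] by (simp add: W_def W'_def nth_rotate)
  qed (simp add: W_def W'_def)
  have p: "p i < g * M" "p i mod g = Q i" "p i div g = i * m + T i" if "i < n" for i
  proof -
    have "Suc i * m \<le> n * m" using that by (intro mult_le_mono1) simp
    \<comment> \<open>\<open>Suc (T i) < m\<close> keeps clear of the place missing from the last
      block.\<close>
    then have "i * m + T i < M" using at[OF that] M by (simp add: mult.commute)
    then have "g * Suc (i * m + T i) \<le> g * M" by (intro mult_le_mono2) simp
    then show "p i < g * M" "p i mod g = Q i" "p i div g = i * m + T i"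
      using at[OF that] g by (simp_all add: p_def)
  qed
  have mono: "strict_mono_on {..<n} p"
  proof (rule strict_mono_onI)
    fix i j assume ij: "i \<in> {..<n}" "j \<in> {..<n}" "i < j"
    then have "Suc i * m \<le> j * m" by (intro mult_le_mono1) simp
    then have "i * m + T i < j * m + T j" using at[of i] ij by simp
    then have "g * Suc (i * m + T i) \<le> g * (j * m + T j)" by (intro mult_le_mono2) simp
    then show "p i < p j" using at[of i] ij by (simp add: p_def)
  qed
  \<comment> \<open>A difference forces the block to be \<open>c q s\<close> and the letter to
    change in sweep \<open>s\<close>. By \<open>const\<close> the block is then a genuine index,
    placed by \<open>p\<close> at \<open>j\<close> itself.\<close>
  have "W ! j = W' ! j" if "j < length W" "j \<notin> p ` {..<n}" for j
  proof (rule ccontr)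
    assume ne: "W ! j \<noteq> W' ! j"
    define q b where "q = j mod g" and "b = j div g"
    have q: "q < g" using g by (simp add: q_def)
    have j: "W ! j = F q b" "W' ! j = G q b"
      using that by (simp_all add: W_def W'_def q_def b_def)
    have eq: "b div m = c q (b mod m)"
    proof (rule ccontr)
      assume "b div m \<noteq> c q (b mod m)"
      then show False using ne j by (auto simp: F_def G_def split: if_splits)
    qed
    then have "h q (Suc (b mod m)) \<noteq> h q (b mod m)" using ne j by (simp add: F_def G_def)
    then have lt: "c q (b mod m) < n" using const[OF q] by (meson not_le)
    then have "p (b div m) = j"
      using c[OF q lt] by (simp add: p_def eq[symmetric]) (simp add: q_def b_def)
    then show False using that lt eq by (metis imageI lessThan_iff)
  qed
  moreover have "length W = length W'" by (simp add: W_def W'_def)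
  ultimately obtain x where x: "W = insertion x (nths W (p ` {..<n}))"
      "W' = insertion x (nths W' (p ` {..<n}))"
    using insertion_nths[of W W' "p ` {..<n}"] by blast
  have "nths W (p ` {..<n}) = u" "nths W' (p ` {..<n}) = v"
  proof -
    have dm: "(i * m + T i) div m = i" "(i * m + T i) mod m = T i" if "i < n" for i
      using at[OF that] by simp_all
    have W: "W ! p i = u ! i" "W' ! p i = v ! i" if "i < n" for i
      using p[OF that] at[OF that] u[OF that] v[OF that] dm[OF that]
      by (simp_all add: W_def W'_def F_def G_def)
    then show "nths W (p ` {..<n}) = u" "nths W' (p ` {..<n}) = v"
      using nths_strict_mono_on[OF mono, of W] nths_strict_mono_on[OF mono, of W'] p(1) len
      by (simp_all add: W_def[symmetric] list_eq_iff_nth_eq) (simp_all add: W_def W'_def)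
  qed
  moreover have "set W \<subseteq> (\<lambda>(q, s). h q s) ` ({..<g} \<times> UNIV)"
    using g by (force simp: W_def F_def)
  ultimately show ?thesis using x rot by metis
qed

section \<open>Symmetry of conjugacy, and the schedule read off the cycles\<close>

lemma cyclically_equivalent_refl: "cyclically_equivalent w w"
  unfolding cyclically_equivalent_def by (metis rotate0 id_apply)

lemma cyclically_equivalent_sym:
  assumes "cyclically_equivalent w w'"
  shows "cyclically_equivalent w' w"
proof -
  obtain r where r: "w' = rotate r w" using assms by (auto simp: cyclically_equivalent_def)
  have "rotate (length w - r mod length w) w' = w"
  proof (cases "w = []")
    case False
    then have "r mod length w < length w" by simp
    moreover have "w' = rotate (r mod length w) w" using r by (metis rotate_conv_mod)
    ultimately show ?thesis by (simp add: rotate_rotate)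
  qed (simp add: r)
  then show ?thesis unfolding cyclically_equivalent_def by metis
qed

text \<open>Each cycle of a permutation taking \<open>u\<close> to \<open>v\<close> gets one orbit
  and schedules its entries in cyclic order. The bound on the letters keeps the inserted words over
  the alphabet.\<close>

lemma mset_eq_imp_equalizable:
  assumes "mset u = mset v" and "u \<noteq> []"
  shows "\<exists>x r. insertion x v = rotate r (insertion x u) \<and> set (insertion x u) \<subseteq> set u"
proof -
  define n where "n = length u"
  have n: "n > 0" using assms by (simp add: n_def)
  have len: "length v = n" using mset_eq_length[OF assms(1)] by (simp add: n_def)
  obtain \<pi> where \<pi>: "\<pi> permutes {..<length u}" "permute_list \<pi> u = v"
    using mset_eq_permutation[OF assms(1)[symmetric]] by blast
  have v_nth: "v ! i = u ! \<pi> i" if "i < n" for i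
    using permute_list_nth[OF \<pi>(1)] that \<pi>(2) by (auto simp: n_def)
  obtain css where css: "distinct (concat css)" "set (concat css) = {..<n}"
    and cyc: "\<And>cs. cs \<in> set css \<Longrightarrow> cs \<noteq> [] \<and> map \<pi> cs = rotate1 cs"
    using permutes_cycle_lists[OF \<pi>(1)] by (auto simp: n_def)
  have bound: "cs ! s < n" if "cs \<in> set css" "s < length cs" for cs s
  proof -
    have "cs ! s \<in> set (concat css)" using that nth_mem by fastforce
    then have "cs ! s \<in> {..<n}" unfolding css(2) .
    then show ?thesis by simp
  qed
  have short: "length cs \<le> n" if "cs \<in> set css" for cs
  proof -
    have "distinct cs" using css(1) that by (simp add: distinct_concat_iff)
    moreover have "set cs \<subseteq> {..<n}" using css(2) that by auto
    ultimately show ?thesis by (metis card_lessThan card_mono distinct_card finite_lessThan)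
  qed
  have "\<forall>i. \<exists>q s. i < n \<longrightarrow> q < length css \<and> s < length (css ! q) \<and> css ! q ! s = i"
    by (metis (no_types, lifting) UN_E css(2) in_set_conv_nth lessThan_iff set_concat)
  then obtain Q T where QT:
    "\<And>i. i < n \<Longrightarrow> Q i < length css \<and> T i < length (css ! Q i) \<and> css ! Q i ! T i = i"
    by metis
  have uniq: "q = q' \<and> s = s'"
    if "q < length css" "q' < length css" "s < length (css ! q)" "s' < length (css ! q')"
      and "css ! q ! s = css ! q' ! s'" for q q' s s'
  proof -
    \<comment> \<open>Nonempty disjoint lists are distinct, so a common entry determines the list
      and then the place in it.\<close>
    have "[] \<notin> set css" using cyc by blast
    then have d: "distinct css" using css(1) by (simp add: distinct_concat_iff)
    have "q = q'"
    proof (rule ccontr)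
      assume "q \<noteq> q'"
      then have "css ! q \<noteq> css ! q'" using d that by (simp add: nth_eq_iff_index_eq)
      then have "set (css ! q) \<inter> set (css ! q') = {}"
        using css(1) that unfolding distinct_concat_iff by (meson nth_mem)
      then show False using that by (metis disjoint_iff nth_mem)
    qed
    moreover have "distinct (css ! q)" using css(1) that by (simp add: distinct_concat_iff)
    ultimately show ?thesis using that by (simp add: nth_eq_iff_index_eq)
  qed
  \<comment> \<open>Once the cycle is exhausted, \<open>c\<close> takes the idle value
    \<open>n\<close> and \<open>h\<close> returns to the first letter of the cycle.\<close>
  define c where "c q s = (if s < length (css ! q) then css ! q ! s else n)" for q s
  define h where "h q s = u ! (css ! q ! (if s < length (css ! q) then s else 0))" for q s
  have "\<exists>x r. insertion x v = rotate r (insertion x u) \<and>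
    set (insertion x u) \<subseteq> (\<lambda>(q, s). h q s) ` ({..<length css} \<times> UNIV)"
  \<comment> \<open>Cycles have length at most \<open>n\<close>, so with \<open>m = n + 2\<close>
    sweeps every cycle is exhausted before sweep \<open>m - 1\<close>, as \<open>wrap\<close>
    demands.\<close>
  proof (rule equalizable_of_schedule[where n = n and m = "n + 2" and c = c and Q = Q and T = T])
    fix i assume i: "i < n"
    note QTi = QT[OF i]
    have mem: "css ! Q i \<in> set css" using QTi by simp
    show "Q i < length css \<and> Suc (T i) < n + 2 \<and> c (Q i) (T i) = i"
      using QTi short[OF mem] by (simp add: c_def)
    show "u ! i = h (Q i) (T i)" using QTi by (simp add: h_def)
    \<comment> \<open>The successor of the last entry is entry 0, which is the default used in
      \<open>h\<close>.\<close>
    have "\<pi> i = rotate1 (css ! Q i) ! T i" using cyc[OF mem] QTi by (metis nth_map)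
    also have "\<dots> = css ! Q i ! (Suc (T i) mod length (css ! Q i))"
      using QTi by (simp add: nth_rotate1)
    finally have "\<pi> i = css ! Q i ! (if Suc (T i) < length (css ! Q i) then Suc (T i) else 0)"
      using QTi by (cases "Suc (T i) = length (css ! Q i)") auto
    then show "v ! i = h (Q i) (Suc (T i))" using v_nth[OF i] by (simp add: h_def)
  next
    fix q s assume q: "q < length css"
    show "Q (c q s) = q \<and> T (c q s) = s" if "c q s < n"
      using that QT[OF that] uniq[OF _ q] by (auto simp: c_def split: if_splits)
    show "h q (Suc s) = h q s" if "c q s \<ge> n"
      using that bound[of "css ! q" s] q by (auto simp: c_def h_def split: if_splits)
    show "h q s = h q 0" if "s \<ge> n + 2 - 1"
      using that short[of "css ! q"] q by (simp add: h_def)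
  qed (use n len in \<open>simp_all add: n_def\<close>)
  moreover have "h q s \<in> set u" if "q < length css" for q s
  proof -
    have "css ! q \<in> set css" using that by simp
    then show ?thesis using bound[of "css ! q" "if s < length (css ! q) then s else 0"] cyc
      by (auto simp: h_def n_def)
  qed
  then have "(\<lambda>(q, s). h q s) ` ({..<length css} \<times> UNIV) \<subseteq> set u" by auto
  ultimately show ?thesis by (meson order_trans)
qed

section \<open>Parikh vectors as multisets, and the equivalence\<close>

lemma parikh_eq_iff_mset_eq:
  assumes "u \<in> lists \<Sigma>" and "v \<in> lists \<Sigma>"
  shows "parikh \<Sigma> u = parikh \<Sigma> v \<longleftrightarrow> mset u = mset v"
proof
  assume eq: "parikh \<Sigma> u = parikh \<Sigma> v"
  show "mset u = mset v"
  proof (rule multiset_eqI)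
    fix a
    show "count (mset u) a = count (mset v) a"
    proof (cases "a \<in> \<Sigma>")
      case True
      then show ?thesis using fun_cong[OF eq, of a] by (simp add: parikh_def count_mset)
    next
      case False
      then have "a \<notin> set u" "a \<notin> set v" using assms by auto
      then show ?thesis by (metis count_mset_0_iff)
    qed
  qed
next
  assume "mset u = mset v"
  then show "parikh \<Sigma> u = parikh \<Sigma> v" by (simp add: parikh_def flip: count_mset)
qed

theorem theorem3:
  fixes \<Sigma> :: "'a set" and u v :: "'a list"
  assumes "finite \<Sigma>"
    and "u \<in> lists \<Sigma>" and "v \<in> lists \<Sigma>"
    and "length u = length v"
  shows "cyclically_equalizable \<Sigma> [u, v] \<longleftrightarrow> parikh \<Sigma> u = parikh \<Sigma> v"
  unfolding parikh_eq_iff_mset_eq[OF assms(2,3)]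
proof
  assume "cyclically_equalizable \<Sigma> [u, v]"
  then obtain x r where "insertion x v = rotate r (insertion x u)"
    by (auto simp: cyclically_equalizable_def cyclically_equivalent_def)
  then have "mset (insertion x v) = mset (insertion x u)"
    by (metis append_take_drop_id mset_append rotate_drop_take union_commute)
  \<comment> \<open>The inserted letters depend only on \<open>x\<close> and the common length, so
    they cancel.\<close>
  then show "mset u = mset v" using assms(4) by (simp add: mset_insertion)
next
  assume eq: "mset u = mset v"
  show "cyclically_equalizable \<Sigma> [u, v]"
  proof (cases "u = []")
    case True
    with assms(4) show ?thesis
      by (auto simp: cyclically_equalizable_def cyclically_equivalent_refl
          intro!: exI[of _ "\<lambda>_. []"])
  next
    case False
    from mset_eq_imp_equalizable[OF eq False] obtain x r where
      x: "insertion x v = rotate r (insertion x u)" "set (insertion x u) \<subseteq> set u" by blast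
    then have "cyclically_equivalent (insertion x u) (insertion x v)"
      by (auto simp: cyclically_equivalent_def)
    moreover have "x i \<in> lists \<Sigma>" if "i \<le> length u" for i
      using x(2) assms(2) that by (fastforce simp: set_insertion)
    ultimately show ?thesis
      using assms by (auto simp: cyclically_equalizable_def cyclically_equivalent_refl
          intro: cyclically_equivalent_sym intro!: exI[of _ "length u"] exI[of _ x])
  qed
qed

end
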